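(* Let $k\in\mathbb N^+$, $A>0$, $\delta>0$, let $d_s\in(0,1)$ be an optimal WENO weight, and let $m_s\in\big[\frac{\alpha_s}{k+1},M\big)$, where $M$ is a finite positive real constant and $\alpha_s>\max\big(0,\max_{0<\omega<1}q_s(\omega)\big)$ with $$q_s(\omega)=(\omega-d_s)\Big(\frac{d_s}{\omega^2}(1-\ln\omega)+\frac{1-d_s}{(1-\omega)^2}(\ln(1-\omega)-1)\Big).$$ Then the mapping function $$(g^{\mathrm{MAIM}1})_s(\omega)=d_s+\frac{f_s^{\mathrm{MAIM}}(\omega)\,(\omega-d_s)^{k+1}}{f_s^{\mathrm{MAIM}}(\omega)\,(\omega-d_s)^k+\omega^{\frac{d_s}{m_s\omega}}(1-\omega)^{\frac{1-d_s}{m_s(1-\omega)}}}$$ satisfies: C1. $(g^{\mathrm{MAIM}1})_s(0)=0$, $(g^{\mathrm{MAIM}1})_s(1)=1$, $(g^{\mathrm{MAIM}1})_s(d_s)=d_s$; C2. $(g^{\mathrm{MAIM}1})_s'(\omega)\ge0$ for $\omega\in(0,1)$; C3. if $k=2n$ with $n\in\mathbb N^+$, then $(g^{\mathrm{MAIM}1})_s'(d_s)=(g^{\mathrm{MAIM}1})_s''(d_s)=\cdots=(g^{\mathrm{MAIM}1})_s^{(k)}(d_s)=0$ and $(g^{\mathrm{MAIM}1})_s^{(k+1)}(d_s)\ne0$; if $k=2n-1$ with $n\in\mathbb N^+$, then $(g^{\mathrm{MAIM}1})_s'(d_s)=(g^{\mathrm{MAIM}1})_s''(d_s)=\cdots=(g^{\mathrm{MAIM}1})_s^{(k+1)}(d_s)=0$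 and $(g^{\mathrm{MAIM}1})_s^{(k+2)}(d_s)\neq0$; C4. $(g^{\mathrm{MAIM}1})_s'(0^+)=(g^{\mathrm{MAIM}1})_s'(1^-)=1$, where $(g^{\mathrm{MAIM}1})_s'(0^+)=\lim_{\omega\to0^+}(g^{\mathrm{MAIM}1})_s'(\omega)$ and $(g^{\mathrm{MAIM}1})_s'(1^-)=\lim_{\omega\to1^-}(g^{\mathrm{MAIM}1})_s'(\omega)$.
   Context: The optimal weights are $d_s=\binom{r}{s}\binom{r-1}{s}/\binom{2r-1}{r}\in(0,1)$, $s=0,\dots,r-1$, $r\in\{2,\dots,9\}$. The function $f_s^{\mathrm{MAIM}}$ of $\omega$ is $$f_s^{\mathrm{MAIM}}(\omega)=A\Big(\frac{1+(-1)^k}{2}+\frac{1+(-1)^{k+1}}{2}\,sg(\omega-d_s,\delta)\Big),$$ i.e. $A$ for even $k$ and $A\,sg(\omega-d_s,\delta)$ for odd $k$, where $\delta>0$ is a (small) constant and $$sg(x,\delta)=\begin{cases}\dfrac{x}{|x|},&|x|\ge\delta,\\[2mm]\dfrac{x}{(\delta^2-x^2)^{k+3}+|x|},&|x|<\delta.\end{cases}$$ Convention: at $\omega=0$ and $\omega=1$ the product $\omega^{\frac{d_s}{m_s\omega}}(1-\omega)^{\frac{1-d_s}{m_s(1-\omega)}}$ is given its limit value $0$. *)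

theory Defs
  imports "HOL-Analysis.Analysis" "HOL-Real_Asymp.Real_Asymp"
begin

definition optimal_weight :: "nat \<Rightarrow> nat \<Rightarrow> real" where
  "optimal_weight r s =
     real (r choose s) * real ((r - 1) choose s) / real ((2 * r - 1) choose r)"

lemma optimal_weight_in_unit_interval:
  assumes "r \<in> {2..9}" "s < r"
  shows "0 < optimal_weight r s" "optimal_weight r s < 1"
proof -
  have pos: "0 < (2 * r - 1) choose r"
    using assms by (intro zero_less_binomial) auto
  show "0 < optimal_weight r s"
    using assms pos by (auto simp: optimal_weight_def zero_less_binomial_iff)
  have "(r choose s) * ((r - 1) choose s) < (2 * r - 1) choose r"
  proof -
    define t where "t = (if s = 0 then 1 else (0::nat))"
    define h where "h = (\<lambda>i. (r choose i) * ((r - 1) choose (r - i)))"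
    have t: "t < r" "t \<noteq> s"
      using assms by (auto simp: t_def)
    have "r - s \<noteq> r - t"
      using t assms(2) by linarith
    then have "h (r - s) + h (r - t) = sum h {r - s, r - t}"
      by simp
    also have "\<dots> \<le> sum h {..r}"
      by (intro sum_mono2) auto
    also have "\<dots> = (r + (r - 1)) choose r"
      unfolding h_def by (rule vandermonde)
    also have "r + (r - 1) = 2 * r - 1"
      by simp
    finally have "h (r - s) + h (r - t) \<le> (2 * r - 1) choose r" .
    moreover have "h (r - s) = (r choose s) * ((r - 1) choose s)"
      using assms(2) by (simp add: h_def binomial_symmetric[symmetric])
    moreover have "h (r - t) > 0"
      using t(1) by (auto simp: h_def zero_less_binomial_iff)
    ultimately show ?thesis
      by linarith
  qed
  then have "real ((r choose s) * ((r - 1) choose s)) < real ((2 * r - 1) choose r)"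
    by (rule of_nat_less_iff[THEN iffD2])
  then show "optimal_weight r s < 1"
    using pos by (simp add: optimal_weight_def)
qed

definition sg :: "nat \<Rightarrow> real \<Rightarrow> real \<Rightarrow> real" where
  "sg k \<delta> x =
     (if \<bar>x\<bar> \<ge> \<delta> then x / \<bar>x\<bar>
      else x / ((\<delta>\<^sup>2 - x\<^sup>2) ^ (k + 3) + \<bar>x\<bar>))"

definition f_MAIM :: "nat \<Rightarrow> real \<Rightarrow> real \<Rightarrow> real \<Rightarrow> real \<Rightarrow> real" where
  "f_MAIM k A \<delta> d \<omega> =
     A * ((1 + (-1) ^ k) / 2 + (1 + (-1) ^ (k + 1)) / 2 * sg k \<delta> (\<omega> - d))"

definition q_fun :: "real \<Rightarrow> real \<Rightarrow> real" where
  "q_fun d \<omega> =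
     (\<omega> - d) * (d / \<omega>\<^sup>2 * (1 - ln \<omega>) + (1 - d) / (1 - \<omega>)\<^sup>2 * (ln (1 - \<omega>) - 1))"

text \<open>The value at the endpoints is the limit value, set explicitly.\<close>

definition weight_product :: "real \<Rightarrow> real \<Rightarrow> real \<Rightarrow> real" where
  "weight_product m d \<omega> =
     (if \<omega> = 0 \<or> \<omega> = 1 then 0
      else \<omega> powr (d / (m * \<omega>)) * (1 - \<omega>) powr ((1 - d) / (m * (1 - \<omega>))))"

definition g_MAIM1 :: "nat \<Rightarrow> real \<Rightarrow> real \<Rightarrow> real \<Rightarrow> real \<Rightarrow> real \<Rightarrow> real" where
  "g_MAIM1 k A \<delta> m d \<omega> =
     d + f_MAIM k A \<delta> d \<omega> * (\<omega> - d) ^ (k + 1) /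
         (f_MAIM k A \<delta> d \<omega> * (\<omega> - d) ^ k + weight_product m d \<omega>)"

text \<open>
  \<^const>\<open>deriv\<close> is total, so an equation about \<open>(deriv ^^ n) f x\<close> is only meaningful
  together with the existence of the derivatives of order up to \<open>n\<close>. The \<open>n\<close>-th derivative
  at \<open>x\<close> exists if the lower ones exist near \<open>x\<close> and the one of order \<open>n - 1\<close> is
  differentiable at \<open>x\<close>.
\<close>

primrec times_differentiable_at :: "nat \<Rightarrow> (real \<Rightarrow> real) \<Rightarrow> real \<Rightarrow> bool" where
  "times_differentiable_at 0 f x \<longleftrightarrow> True"
| "times_differentiable_at (Suc n) f x \<longleftrightarrow>
     (\<forall>\<^sub>F y in nhds x. times_differentiable_at n f y) \<and>
     ((deriv ^^ n) f) field_differentiable (at x)"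

text \<open>
  The maximum of \<^const>\<open>q_fun\<close> over the open unit interval is attained, so it equals
  the supremum.
\<close>

lemma q_fun_attains_max:
  assumes "0 < d" "d < 1"
  shows "\<exists>w\<in>{0<..<1}. \<forall>\<omega>\<in>{0<..<1}. q_fun d \<omega> \<le> q_fun d w"
proof -
  have near_0: "\<exists>a>0. \<forall>x. 0 < x \<and> x < a \<longrightarrow> q_fun c x \<le> 0" if "0 < c" "c < 1" for c
  proof -
    have "filterlim (q_fun c) at_bot (at_right 0)"
      unfolding q_fun_def using that by real_asymp
    then have "\<forall>\<^sub>F x in at_right 0. q_fun c x \<le> 0"
      by (simp add: filterlim_at_bot)
    then show ?thesis
      by (auto simp: eventually_at_right_field)
  qed
  have sym: "q_fun d x = q_fun (1 - d) (1 - x)" for x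
    by (simp add: q_fun_def algebra_simps)
  obtain a where a: "a > 0" "\<And>x. 0 < x \<Longrightarrow> x < a \<Longrightarrow> q_fun d x \<le> 0"
    using near_0[OF assms] by blast
  obtain a' where a': "a' > 0" "\<And>x. 0 < x \<Longrightarrow> x < a' \<Longrightarrow> q_fun (1 - d) x \<le> 0"
    using near_0[of "1 - d"] assms by auto
  define b where "b = 1 - a'"
  have b: "b < 1" "\<And>x. b < x \<Longrightarrow> x < 1 \<Longrightarrow> q_fun d x \<le> 0"
    using a' by (simp_all add: b_def sym)
  define K where "K = {min a d..max b d}"
  have K: "compact K" "d \<in> K" "K \<subseteq> {0<..<1}"
    using assms a(1) b(1) by (auto simp: K_def)
  have "continuous_on K (q_fun d)"
    unfolding q_fun_def using K(3) by (intro continuous_intros) auto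
  then obtain w where w: "w \<in> K" "\<And>x. x \<in> K \<Longrightarrow> q_fun d x \<le> q_fun d w"
    using continuous_attains_sup[of K "q_fun d"] K by blast
  have "q_fun d w \<ge> 0"
    using w(2)[OF K(2)] by (simp add: q_fun_def)
  then have "q_fun d x \<le> q_fun d w" if "x \<in> {0<..<1}" for x
    using that w(2)[of x] a(2)[of x] b(2)[of x] unfolding K_def by fastforce
  then show ?thesis
    using w(1) K(3) by blast
qed

corollary q_fun_max_eq_Sup:
  assumes "0 < d" "d < 1"
  shows "\<exists>w\<in>{0<..<1}. (SUP \<omega>\<in>{0<..<1}. q_fun d \<omega>) = q_fun d w"
  using q_fun_attains_max[OF assms] by (metis (mono_tags, lifting) cSup_eq_maximum imageE imageI)

end

theory Submission
  imports Defs
begin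

text \<open>
  Write \<open>x = \<omega> - d\<close> and let \<open>P\<close> be the weight product. For even \<open>k\<close> the mapping is
  \<open>d + A x^(k+1) / (A x^k + P)\<close>. For odd \<open>k\<close> the smoothed sign is a single fraction \<open>x / E x\<close>
  with \<open>E x = max 0 (\<delta>^2 - x^2)^(k+3) + \<bar>x\<bar> > 0\<close>: the two branches of its definition meet smoothly
  because the bump vanishes to high order at \<open>\<bar>x\<bar> = \<delta>\<close>. Clearing \<open>E\<close> gives
  \<open>d + A x^(k+2) / (A x^(k+1) + P E)\<close>. Hence both parities are instances of
  \<open>g = d + A x^(p+1) / (A x^p + Q)\<close> with \<open>p\<close> even and \<open>Q = P * E\<close>, where \<open>(p, E) = (k, 1)\<close> or
  \<open>(k + 1, E)\<close>; the locale \<open>blended_mapping\<close> treats them together.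

  Monotonicity: by the quotient rule, \<open>g'\<close> is a nonnegative multiple of
  \<open>A x^p + ((p + 1) Q - x Q')\<close>. Logarithmic differentiation gives \<open>x P' = (q / m) P\<close>, and
  \<open>q / m \<le> k + 1\<close> is what the lower bound on \<open>m\<close> provides. In the odd case
  \<open>x E' \<le> E\<close>, which pays for the one extra power. So \<open>x Q' \<le> (p + 1) Q\<close>.

  Flatness at \<open>d\<close>: \<open>g = d + x^(p+1) h\<close>, where \<open>h\<close> is continuous and is smooth on either side of
  \<open>d\<close>, and \<open>h d > 0\<close>. In the odd case \<open>h\<close> has a corner at \<open>d\<close> coming from \<open>\<bar>x\<bar>\<close>, but each
  differentiation only trades one power of \<open>x\<close>, so \<open>p + 1\<close> derivatives exist, the first \<open>p\<close> vanish
  at \<open>d\<close>, and the last one is \<open>(p + 1)! * h d\<close> (lemma \<open>contact_order\<close>).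

  Endpoints: \<open>P\<close> and \<open>P'\<close> tend to 0 at both ends, faster than any power, so \<open>g'\<close>
  tends to \<open>(A x^p)^2 / (A x^p)^2 = 1\<close>.
\<close>

section \<open>Finite-order differentiability on a set\<close>

text \<open>
  The derivatives are existentially quantified functions rather than values of \<^const>\<open>deriv\<close>, so
  that the closure properties below reduce to the differentiation rules by induction on the order.
\<close>

primrec differentiable_upto :: "nat \<Rightarrow> real set \<Rightarrow> (real \<Rightarrow> real) \<Rightarrow> bool" where
  "differentiable_upto 0 S f \<longleftrightarrow> True"
| "differentiable_upto (Suc n) S f \<longleftrightarrow>
     (\<exists>f'. (\<forall>x\<in>S. (f has_real_derivative f' x) (at x)) \<and> differentiable_upto n S f')"

lemma differentiable_upto_SucI:
  assumes "\<And>x. x \<in> S \<Longrightarrow> (f has_real_derivative f' x) (at x)" "differentiable_upto n S f'"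
  shows "differentiable_upto (Suc n) S f"
  using assms by auto

lemma differentiable_upto_Suc_imp: "differentiable_upto (Suc n) S f \<Longrightarrow> differentiable_upto n S f"
  by (induction n arbitrary: f) auto

lemma differentiable_upto_const: "differentiable_upto n S (\<lambda>x. c)"
proof (induction n arbitrary: c)
  case (Suc n)
  then show ?case
    by (intro differentiable_upto_SucI[where f' = "\<lambda>_. 0"]) auto
qed simp

lemma differentiable_upto_ident: "differentiable_upto n S (\<lambda>x. x)"
proof (cases n)
  case (Suc n')
  show ?thesis
    unfolding Suc
    by (rule differentiable_upto_SucI[OF _ differentiable_upto_const[of n' S 1]]) simp
qed simp

lemma differentiable_upto_add:
  "differentiable_upto n S f \<Longrightarrow> differentiable_upto n S g \<Longrightarrow> differentiable_upto n S (\<lambda>x. f x + g x)"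
proof (induction n arbitrary: f g)
  case (Suc n)
  then obtain f' g' where
    "\<forall>x\<in>S. (f has_real_derivative f' x) (at x)" "differentiable_upto n S f'"
    "\<forall>x\<in>S. (g has_real_derivative g' x) (at x)" "differentiable_upto n S g'"
    by auto
  then have "\<forall>x\<in>S. ((\<lambda>x. f x + g x) has_real_derivative f' x + g' x) (at x)"
    "differentiable_upto n S (\<lambda>x. f' x + g' x)"
    using Suc.IH by (auto intro: DERIV_add)
  then show ?case
    by (auto intro!: exI[of _ "\<lambda>x. f' x + g' x"])
qed simp

lemma differentiable_upto_mult:
  "differentiable_upto n S f \<Longrightarrow> differentiable_upto n S g \<Longrightarrow> differentiable_upto n S (\<lambda>x. f x * g x)"
proof (induction n arbitrary: f g)
  case (Suc n)
  then obtain f' g' where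
    D: "\<forall>x\<in>S. (f has_real_derivative f' x) (at x)" "differentiable_upto n S f'"
    "\<forall>x\<in>S. (g has_real_derivative g' x) (at x)" "differentiable_upto n S g'"
    by auto
  have "differentiable_upto n S f" "differentiable_upto n S g"
    using Suc.prems by (auto intro!: differentiable_upto_Suc_imp simp del: differentiable_upto.simps)
  then have "\<forall>x\<in>S. ((\<lambda>x. f x * g x) has_real_derivative f' x * g x + g' x * f x) (at x)"
    "differentiable_upto n S (\<lambda>x. f' x * g x + g' x * f x)"
    using D Suc.IH by (auto intro: DERIV_mult differentiable_upto_add)
  then show ?case
    by (auto intro!: exI[of _ "\<lambda>x. f' x * g x + g' x * f x"])
qed simp

lemma differentiable_upto_power:
  "differentiable_upto n S f \<Longrightarrow> differentiable_upto n S (\<lambda>x. f x ^ j)"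
  by (induction j) (auto intro: differentiable_upto_const differentiable_upto_mult)

lemma differentiable_upto_diff:
  "differentiable_upto n S f \<Longrightarrow> differentiable_upto n S g \<Longrightarrow> differentiable_upto n S (\<lambda>x. f x - g x)"
  using differentiable_upto_add[of n S f "\<lambda>x. (-1) * g x"]
    differentiable_upto_mult[of n S "\<lambda>x. -1" g] differentiable_upto_const[of n S "-1"]
  by simp

lemma differentiable_upto_compose:
  assumes "differentiable_upto n T f" "differentiable_upto n S g" "\<And>x. x \<in> S \<Longrightarrow> g x \<in> T"
  shows "differentiable_upto n S (\<lambda>x. f (g x))"
  using assms
proof (induction n arbitrary: f)
  case (Suc n)
  then obtain f' g' where
    D: "\<forall>x\<in>T. (f has_real_derivative f' x) (at x)" "differentiable_upto n T f'"
    "\<forall>x\<in>S. (g has_real_derivative g' x) (at x)" "differentiable_upto n S g'"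
    by auto
  have "differentiable_upto n S g"
    using Suc.prems(2) by (rule differentiable_upto_Suc_imp)
  then have "differentiable_upto n S (\<lambda>x. f' (g x) * g' x)"
    using D Suc.IH Suc.prems(3) by (auto intro!: differentiable_upto_mult)
  then show ?case
    using D Suc.prems(3) by (intro differentiable_upto_SucI[OF DERIV_chain2[of f _ g]]) auto
qed simp

lemma differentiable_upto_exp: "differentiable_upto n S exp"
proof (induction n)
  case (Suc n)
  then show ?case
    by (auto intro!: exI[of _ exp])
qed simp

lemma differentiable_upto_inverse: "differentiable_upto n (- {0}) inverse"
proof (induction n)
  case (Suc n)
  have "\<forall>x\<in>- {0::real}. (inverse has_real_derivative (-1) * (inverse x * inverse x)) (at x)"
    by (auto intro!: derivative_eq_intros)
  moreover have "differentiable_upto n (- {0}) (\<lambda>x. (-1) * (inverse x * inverse x))"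
    using Suc by (intro differentiable_upto_mult differentiable_upto_const)
  ultimately show ?case
    by (auto intro!: exI[of _ "\<lambda>x. (-1) * (inverse x * inverse x)"])
qed simp

lemma differentiable_upto_mono:
  "differentiable_upto n T f \<Longrightarrow> S \<subseteq> T \<Longrightarrow> differentiable_upto n S f"
  by (induction n arbitrary: f) auto

lemma differentiable_upto_ln: "differentiable_upto n {0<..} ln"
proof (cases n)
  case (Suc n')
  have "\<forall>x\<in>{0<..}. (ln has_real_derivative inverse x) (at x)"
    by (auto intro: DERIV_ln)
  moreover have "differentiable_upto n' {0<..} inverse"
    by (rule differentiable_upto_mono[OF differentiable_upto_inverse]) auto
  ultimately show ?thesis
    unfolding Suc differentiable_upto.simps by blast
qed simp

lemma differentiable_upto_divide:
  assumes "differentiable_upto n S f" "differentiable_upto n S g" "\<And>x. x \<in> S \<Longrightarrow> g x \<noteq> 0"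
  shows "differentiable_upto n S (\<lambda>x. f x / g x)"
  unfolding divide_inverse
  by (intro differentiable_upto_mult assms(1)
      differentiable_upto_compose[OF differentiable_upto_inverse assms(2)]) (use assms(3) in auto)

lemmas differentiable_upto_intros =
  differentiable_upto_const differentiable_upto_ident differentiable_upto_add
  differentiable_upto_diff differentiable_upto_mult differentiable_upto_power
  differentiable_upto_divide

section \<open>Order of contact at a point\<close>

text \<open>
  \<^const>\<open>times_differentiable_at\<close> peels off the last derivative; an induction that passes from
  \<open>f\<close> to its derivative has to peel off the first one instead.
\<close>

lemma times_differentiable_at_Suc_deriv:
  assumes "\<forall>\<^sub>F y in nhds x. f field_differentiable (at y)" "times_differentiable_at (Suc n) (deriv f) x"
  shows "times_differentiable_at (Suc (Suc n)) f x"
  using assms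
proof (induction n arbitrary: x)
  case 0
  then show ?case
    by (auto simp: eventually_eventually)
next
  case (Suc n)
  have "\<forall>\<^sub>F y in nhds x. times_differentiable_at (Suc n) (deriv f) y"
    using Suc.prems(2) by simp
  moreover have "\<forall>\<^sub>F y in nhds x. \<forall>\<^sub>F z in nhds y. f field_differentiable (at z)"
    using Suc.prems(1) by (simp only: eventually_eventually)
  ultimately have "\<forall>\<^sub>F y in nhds x. times_differentiable_at (Suc (Suc n)) f y"
    by eventually_elim (rule Suc.IH)
  moreover have "(deriv ^^ Suc (Suc n)) f field_differentiable (at x)"
    using Suc.prems(2) unfolding times_differentiable_at.simps(2)[of "Suc n"]
    by (simp only: funpow_Suc_right o_def)
  ultimately show ?case
    unfolding times_differentiable_at.simps(2)[of "Suc (Suc n)"] by blast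
qed

text \<open>
  The class of functions \<open>a + (x - c)^(n+1) * w\<close>, with \<open>w\<close> equal to \<open>u\<close> on the right and to
  \<open>v\<close> on the left of \<open>c\<close>, is mapped by differentiation to the same class with \<open>n\<close> for
  \<open>n + 1\<close>. At \<open>c\<close> itself continuity of \<open>w\<close> suffices, by Caratheodory's characterisation of the
  derivative; the values \<open>u' c\<close> and \<open>v' c\<close> may differ, since the factor \<open>x - c\<close> kills them.
\<close>

lemma glued_power_deriv:
  fixes f u v :: "real \<Rightarrow> real"
  assumes S: "open S" and u: "\<And>x. x \<in> S \<Longrightarrow> (u has_real_derivative u' x) (at x)"
    and v: "\<And>x. x \<in> S \<Longrightarrow> (v has_real_derivative v' x) (at x)" and eq: "u c = v c"
    and r: "\<And>x. x \<in> S \<Longrightarrow> c \<le> x \<Longrightarrow> f x = a + (x - c) ^ Suc n * u x"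
    and l: "\<And>x. x \<in> S \<Longrightarrow> x \<le> c \<Longrightarrow> f x = a + (x - c) ^ Suc n * v x"
    and x: "x \<in> S"
  shows "c \<le> x \<Longrightarrow>
      (f has_real_derivative (x - c) ^ n * (real (Suc n) * u x + (x - c) * u' x)) (at x)" (is "_ \<Longrightarrow> ?R")
    and "x \<le> c \<Longrightarrow>
      (f has_real_derivative (x - c) ^ n * (real (Suc n) * v x + (x - c) * v' x)) (at x)" (is "_ \<Longrightarrow> ?L")
proof -
  have right: ?R if "c < x"
  proof (rule has_field_derivative_transform_within_open[where S = "S \<inter> {c<..}"])
    show "((\<lambda>x. a + (x - c) ^ Suc n * u x) has_real_derivative
        (x - c) ^ n * (real (Suc n) * u x + (x - c) * u' x)) (at x)"
      by (rule derivative_eq_intros u x refl | simp add: algebra_simps)+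
  qed (use S x that r in auto)
  have left: ?L if "x < c"
  proof (rule has_field_derivative_transform_within_open[where S = "S \<inter> {..<c}"])
    show "((\<lambda>x. a + (x - c) ^ Suc n * v x) has_real_derivative
        (x - c) ^ n * (real (Suc n) * v x + (x - c) * v' x)) (at x)"
      by (rule derivative_eq_intros v x refl | simp add: algebra_simps)+
  qed (use S x that l in auto)
  have centre: "(f has_real_derivative 0 ^ n * u c) (at c)" if "c \<in> S"
  proof -
    define w where "w = (\<lambda>z. if z \<le> c then v z else u z)"
    have "isCont u c" "isCont v c"
      using u[OF that] v[OF that] by (auto intro: DERIV_isCont)
    then have "continuous (at_left c) v" "(u \<longlongrightarrow> v c) (at_right c)"
      using eq continuous_at_imp_continuous_at_within[of c v "{..<c}"]
        continuous_at_imp_continuous_at_within[of c u "{c<..}"]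
      by (simp_all add: continuous_within)
    then have "isCont w c"
      unfolding w_def by (rule isCont_If_ge)
    then have "isCont (\<lambda>z. (z - c) ^ n * w z) c"
      by (intro continuous_intros)
    then have "((\<lambda>z. a + (z - c) * ((z - c) ^ n * w z)) has_real_derivative (c - c) ^ n * w c) (at c)"
      unfolding CARAT_DERIV by (intro exI[of _ "\<lambda>z. (z - c) ^ n * w z"]) simp
    then have "(f has_real_derivative (c - c) ^ n * w c) (at c)"
      by (rule has_field_derivative_transform_within_open[OF _ S that]) (use r l in \<open>auto simp: w_def\<close>)
    then show ?thesis
      using eq by (simp add: w_def)
  qed
  \<comment> \<open>For \<open>n = 0\<close> the value is \<open>u c\<close>, otherwise 0, whatever the derivatives of \<open>u\<close> and \<open>v\<close> are.\<close>
  have centre': "(f has_real_derivative (c - c) ^ n * (real (Suc n) * u c + (c - c) * y)) (at c)" if "c \<in> S" for y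
    using centre[OF that] by (cases n) auto
  show "c \<le> x \<Longrightarrow> ?R"
    using right centre' x by (cases "x = c") auto
  show "x \<le> c \<Longrightarrow> ?L"
    using left centre' x eq by (cases "x = c") auto
qed

text \<open>
  Iterating the previous lemma: a corner of the cofactor at \<open>c\<close> does not spoil the existence of the
  derivative of order \<open>n + 1\<close> there, because the remaining power of \<open>x - c\<close> absorbs it each time.
\<close>

lemma contact_order:
  fixes f u v :: "real \<Rightarrow> real"
  assumes "open S" "c \<in> S" "differentiable_upto (Suc n) S u" "differentiable_upto (Suc n) S v" "u c = v c"
    and "\<And>x. x \<in> S \<Longrightarrow> c \<le> x \<Longrightarrow> f x = a + (x - c) ^ Suc n * u x"
    and "\<And>x. x \<in> S \<Longrightarrow> x \<le> c \<Longrightarrow> f x = a + (x - c) ^ Suc n * v x"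
  shows "times_differentiable_at (Suc n) f c \<and> (\<forall>j\<in>{1..n}. (deriv ^^ j) f c = 0) \<and>
    (deriv ^^ Suc n) f c = fact (Suc n) * u c"
  using assms(3-7)
proof (induction n arbitrary: f u v a)
  case 0
  from 0(1,2) obtain u' v' where "\<And>x. x \<in> S \<Longrightarrow> (u has_real_derivative u' x) (at x)"
    "\<And>x. x \<in> S \<Longrightarrow> (v has_real_derivative v' x) (at x)"
    unfolding differentiable_upto.simps by blast
  from glued_power_deriv(1)[OF assms(1) this 0(3-5) assms(2)]
  have D: "(f has_real_derivative u c) (at c)"
    by simp
  then have "f field_differentiable (at c)"
    unfolding field_differentiable_def by blast
  with DERIV_imp_deriv[OF D] show ?case
    by simp
next
  case (Suc n)
  from Suc.prems(1,2) obtain u' v' where u: "\<And>x. x \<in> S \<Longrightarrow> (u has_real_derivative u' x) (at x)"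
      "differentiable_upto (Suc n) S u'"
    and v: "\<And>x. x \<in> S \<Longrightarrow> (v has_real_derivative v' x) (at x)" "differentiable_upto (Suc n) S v'"
    unfolding differentiable_upto.simps(2)[of "Suc n"] by blast
  define U where "U = (\<lambda>x. real (Suc (Suc n)) * u x + (x - c) * u' x)"
  define V where "V = (\<lambda>x. real (Suc (Suc n)) * v x + (x - c) * v' x)"
  have D1: "(f has_real_derivative (x - c) ^ Suc n * U x) (at x)" if "x \<in> S" "c \<le> x" for x
    unfolding U_def by (rule glued_power_deriv(1)[OF assms(1) u(1) v(1) Suc.prems(3-5)]) (use that in auto)
  have D2: "(f has_real_derivative (x - c) ^ Suc n * V x) (at x)" if "x \<in> S" "x \<le> c" for x
    unfolding V_def by (rule glued_power_deriv(2)[OF assms(1) u(1) v(1) Suc.prems(3-5)]) (use that in auto)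
  have "f field_differentiable (at x)" if "x \<in> S" for x
    using D1[OF that] D2[OF that] linear[of c x] unfolding field_differentiable_def by blast
  then have fd: "\<forall>\<^sub>F y in nhds c. f field_differentiable (at y)"
    using assms(1,2) eventually_nhds by blast
  have "differentiable_upto (Suc n) S U" "differentiable_upto (Suc n) S V"
    unfolding U_def V_def
    by (intro differentiable_upto_intros u(2) v(2)
        differentiable_upto_Suc_imp[OF Suc.prems(1)] differentiable_upto_Suc_imp[OF Suc.prems(2)])+
  moreover have "U c = V c"
    using Suc.prems(3) by (simp add: U_def V_def)
  moreover have "deriv f x = 0 + (x - c) ^ Suc n * U x" if "x \<in> S" "c \<le> x" for x
    using D1[OF that] by (simp add: DERIV_imp_deriv)
  moreover have "deriv f x = 0 + (x - c) ^ Suc n * V x" if "x \<in> S" "x \<le> c" for x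
    using D2[OF that] by (simp add: DERIV_imp_deriv)
  ultimately have IH: "times_differentiable_at (Suc n) (deriv f) c"
    "\<And>j. j \<in> {1..n} \<Longrightarrow> (deriv ^^ j) (deriv f) c = 0"
    "(deriv ^^ Suc n) (deriv f) c = fact (Suc n) * U c"
    using Suc.IH[of U V "deriv f" 0] by blast+
  have "deriv f c = 0"
    using DERIV_imp_deriv[OF D1[OF assms(2)]] by simp
  then have "(deriv ^^ j) f c = 0" if "j \<in> {1..Suc n}" for j
    using that IH(2)[of "j - 1"] by (cases j; cases "j = 1") (auto simp: funpow_Suc_right simp del: funpow.simps)
  moreover have "(deriv ^^ Suc (Suc n)) f c = fact (Suc (Suc n)) * u c"
    using IH(3) unfolding funpow_Suc_right[of "Suc n"] by (simp add: U_def algebra_simps)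
  ultimately show ?case
    using times_differentiable_at_Suc_deriv[OF fd IH(1)] by blast
qed

lemma times_differentiable_at_imp_field_differentiable:
  "times_differentiable_at (Suc n) f x \<Longrightarrow> f field_differentiable (at x)"
proof (induction n)
  case (Suc n)
  then have "\<forall>\<^sub>F y in nhds x. times_differentiable_at (Suc n) f y"
    by simp
  from eventually_nhds_x_imp_x[OF this] show ?case
    by (rule Suc.IH)
qed simp

section \<open>The weight product\<close>

lemma weight_product_eq_exp:
  assumes "0 < \<omega>" "\<omega> < 1"
  shows "weight_product m d \<omega> = exp (d / (m * \<omega>) * ln \<omega> + (1 - d) / (m * (1 - \<omega>)) * ln (1 - \<omega>))"
  using assms by (simp add: weight_product_def powr_def exp_add)

lemma weight_product_pos: "0 < \<omega> \<Longrightarrow> \<omega> < 1 \<Longrightarrow> weight_product m d \<omega> > 0"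
  by (simp add: weight_product_eq_exp)

text \<open>
  The bracket is the logarithmic derivative times \<open>m\<close>; multiplied by \<open>\<omega> - d\<close> it becomes
  \<^const>\<open>q_fun\<close>, which is where the condition on \<open>m\<close> comes from.
\<close>

definition weight_product_deriv :: "real \<Rightarrow> real \<Rightarrow> real \<Rightarrow> real" where
  "weight_product_deriv m d \<omega> = weight_product m d \<omega> *
     ((d / \<omega>\<^sup>2 * (1 - ln \<omega>) + (1 - d) / (1 - \<omega>)\<^sup>2 * (ln (1 - \<omega>) - 1)) / m)"

lemma weight_product_has_derivative:
  assumes "0 < \<omega>" "\<omega> < 1" "m > 0"
  shows "(weight_product m d has_real_derivative weight_product_deriv m d \<omega>) (at \<omega>)"
proof (rule has_field_derivative_transform_within_open[where S = "{0<..<1}"])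
  show "((\<lambda>\<omega>. exp (d / (m * \<omega>) * ln \<omega> + (1 - d) / (m * (1 - \<omega>)) * ln (1 - \<omega>)))
      has_real_derivative weight_product_deriv m d \<omega>) (at \<omega>)"
    unfolding weight_product_deriv_def weight_product_eq_exp[OF assms(1,2)] add_divide_distrib
  proof (intro DERIV_fun_exp DERIV_add)
    show "((\<lambda>\<omega>. d / (m * \<omega>) * ln \<omega>) has_real_derivative d / \<omega>\<^sup>2 * (1 - ln \<omega>) / m) (at \<omega>)"
      using assms by (auto intro!: derivative_eq_intros simp: field_simps power2_eq_square)
    show "((\<lambda>\<omega>. (1 - d) / (m * (1 - \<omega>)) * ln (1 - \<omega>)) has_real_derivative
        (1 - d) / (1 - \<omega>)\<^sup>2 * (ln (1 - \<omega>) - 1) / m) (at \<omega>)"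
      using assms by (auto intro!: derivative_eq_intros simp: divide_simps power2_eq_square)
        (simp add: algebra_simps)
  qed
qed (use assms in \<open>auto simp: weight_product_eq_exp\<close>)

text \<open>
  The exponent behaves like \<open>d * ln \<omega> / (m * \<omega>)\<close> near 0, and symmetrically near 1, so its
  exponential beats the poles of the logarithmic derivative.
\<close>

lemma weight_product_tendsto_0:
  assumes "0 < d" "d < 1" "m > 0"
  shows "(weight_product m d \<longlongrightarrow> 0) (at_right 0)" "(weight_product m d \<longlongrightarrow> 0) (at_left 1)"
    "(weight_product_deriv m d \<longlongrightarrow> 0) (at_right 0)" "(weight_product_deriv m d \<longlongrightarrow> 0) (at_left 1)"
proof -
  let ?P = "\<lambda>\<omega>. exp (d / (m * \<omega>) * ln \<omega> + (1 - d) / (m * (1 - \<omega>)) * ln (1 - \<omega>))"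
  let ?P' = "\<lambda>\<omega>. ?P \<omega> * ((d / \<omega>\<^sup>2 * (1 - ln \<omega>) + (1 - d) / (1 - \<omega>)\<^sup>2 * (ln (1 - \<omega>) - 1)) / m)"
  have 0: "\<forall>\<^sub>F \<omega> in at_right 0. 0 < \<omega> \<and> \<omega> < (1::real)"
    by (auto simp: eventually_at_right_field intro!: exI[of _ 1])
  have 1: "\<forall>\<^sub>F \<omega> in at_left 1. 0 < \<omega> \<and> \<omega> < (1::real)"
    by (auto simp: eventually_at_left_field intro!: exI[of _ 0])
  have "(?P \<longlongrightarrow> 0) (at_right 0)" "(?P \<longlongrightarrow> 0) (at_left 1)"
    using assms by real_asymp+
  then show "(weight_product m d \<longlongrightarrow> 0) (at_right 0)" "(weight_product m d \<longlongrightarrow> 0) (at_left 1)"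
    by (auto elim!: Lim_transform_eventually intro: eventually_mono[OF 0] eventually_mono[OF 1]
        simp: weight_product_eq_exp)
  have "(?P' \<longlongrightarrow> 0) (at_right 0)" "(?P' \<longlongrightarrow> 0) (at_left 1)"
    using assms by real_asymp+
  then show "(weight_product_deriv m d \<longlongrightarrow> 0) (at_right 0)" "(weight_product_deriv m d \<longlongrightarrow> 0) (at_left 1)"
    by (auto elim!: Lim_transform_eventually intro: eventually_mono[OF 0] eventually_mono[OF 1]
        simp: weight_product_eq_exp weight_product_deriv_def)
qed

text \<open>
  The supremum of a real set says nothing unless the set is bounded above; here the maximum is
  attained.
\<close>

lemma q_fun_less_of_Sup_less:
  assumes "0 < d" "d < 1" "(SUP \<omega>\<in>{0<..<1}. q_fun d \<omega>) < \<alpha>" "\<omega> \<in> {0<..<1}"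
  shows "q_fun d \<omega> < \<alpha>"
proof -
  have "bdd_above (q_fun d ` {0<..<1})"
    using q_fun_attains_max[OF assms(1,2)] by (auto intro: bdd_aboveI2)
  then show ?thesis
    using cSUP_upper[OF assms(4)] assms(3) by fastforce
qed

section \<open>Mappings with a blended denominator\<close>

text \<open>
  The derivative is arranged so that its sign and its limit as \<open>Q\<close> and \<open>Q'\<close> tend to 0 can be
  read off.
\<close>

lemma blended_fraction_has_derivative:
  fixes Q :: "real \<Rightarrow> real"
  assumes "(Q has_real_derivative Q') (at \<omega>)" "A * (\<omega> - d) ^ p + Q \<omega> \<noteq> 0" "p \<ge> 1"
  shows "((\<lambda>\<omega>. d + A * (\<omega> - d) ^ Suc p / (A * (\<omega> - d) ^ p + Q \<omega>)) has_real_derivative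
     A * (\<omega> - d) ^ p * (A * (\<omega> - d) ^ p + (real (Suc p) * Q \<omega> - (\<omega> - d) * Q')) /
       (A * (\<omega> - d) ^ p + Q \<omega>)\<^sup>2) (at \<omega>)"
proof -
  obtain n where p: "p = Suc n"
    using assms(3) by (cases p) auto
  show ?thesis
    by (rule derivative_eq_intros assms(1,2) refl)+
      (simp add: p field_simps power2_eq_square)
qed

text \<open>
  The factor \<open>E\<close> is the denominator of the smoothed sign, or 1 if no sign occurs. It may have a
  corner at 0, so its derivative is only required elsewhere; near 0 it is \<open>Er\<close> on the right and
  \<open>El\<close> on the left. \<open>E_growth\<close> says that \<open>E\<close> grows at most like \<open>x^(p-k)\<close>, so that the bound
  \<open>k + 1\<close> for the weight product becomes \<open>p + 1\<close> for \<open>Q\<close>.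
\<close>

locale blended_mapping =
  fixes d A m :: real and k p :: nat and E E' Er El g :: "real \<Rightarrow> real" and T :: "real set"
  assumes d: "0 < d" "d < 1" and A: "A > 0" and m: "m > 0" and p: "even p" "p \<ge> 1"
    and q_le: "\<omega> \<in> {0<..<1} \<Longrightarrow> q_fun d \<omega> \<le> real (k + 1) * m"
    and E_pos: "E x > 0"
    and E_deriv: "x \<noteq> 0 \<Longrightarrow> (E has_real_derivative E' x) (at x)"
    and E'_cont: "x \<noteq> 0 \<Longrightarrow> isCont E' x"
    and E_growth: "x * E' x \<le> (real p - real k) * E x"
    and T: "open T" "0 \<in> T"
    and Er: "differentiable_upto (Suc p) T Er" "x \<in> T \<Longrightarrow> Er x > 0" "x \<in> T \<Longrightarrow> 0 \<le> x \<Longrightarrow> E x = Er x"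
    and El: "differentiable_upto (Suc p) T El" "x \<in> T \<Longrightarrow> El x > 0" "x \<in> T \<Longrightarrow> x \<le> 0 \<Longrightarrow> E x = El x"
    and g_eq: "\<omega> \<in> {0..1} \<Longrightarrow>
      g \<omega> = d + A * (\<omega> - d) ^ Suc p / (A * (\<omega> - d) ^ p + weight_product m d \<omega> * E (\<omega> - d))"
begin

definition Q :: "real \<Rightarrow> real" where
  "Q \<omega> = weight_product m d \<omega> * E (\<omega> - d)"

definition Q' :: "real \<Rightarrow> real" where
  "Q' \<omega> = weight_product_deriv m d \<omega> * E (\<omega> - d) + E' (\<omega> - d) * weight_product m d \<omega>"

definition G' :: "real \<Rightarrow> real" where
  "G' \<omega> = A * (\<omega> - d) ^ p *
    (A * (\<omega> - d) ^ p + (real (Suc p) * Q \<omega> - (\<omega> - d) * Q' \<omega>)) / (A * (\<omega> - d) ^ p + Q \<omega>)\<^sup>2"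

lemma power_nonneg: "A * x ^ p \<ge> 0"
  using A p by (simp add: zero_le_even_power)

lemma Q_pos: "\<omega> \<in> {0<..<1} \<Longrightarrow> Q \<omega> > 0"
  using weight_product_pos[of \<omega> m d] E_pos by (simp add: Q_def)

lemma Q_has_derivative:
  assumes "\<omega> \<in> {0<..<1}" "\<omega> \<noteq> d"
  shows "(Q has_real_derivative Q' \<omega>) (at \<omega>)"
proof -
  have "((\<lambda>\<omega>. E (\<omega> - d)) has_real_derivative E' (\<omega> - d) * 1) (at \<omega>)"
    by (rule DERIV_chain2[of E _ "\<lambda>\<omega>. \<omega> - d"])
      (use E_deriv[of "\<omega> - d"] assms in \<open>auto intro!: derivative_eq_intros\<close>)
  then show ?thesis
    unfolding Q_def[abs_def] Q'_def using assms m
    by (auto intro!: DERIV_mult weight_product_has_derivative)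
qed

lemma has_derivative_G':
  assumes "\<omega> \<in> {0<..<1}" "\<omega> \<noteq> d"
  shows "(g has_real_derivative G' \<omega>) (at \<omega>)"
proof (rule has_field_derivative_transform_within_open[where S = "{0<..<1}"])
  show "((\<lambda>\<omega>. d + A * (\<omega> - d) ^ Suc p / (A * (\<omega> - d) ^ p + Q \<omega>)) has_real_derivative G' \<omega>) (at \<omega>)"
    unfolding G'_def using power_nonneg[of "\<omega> - d"] Q_pos[OF assms(1)] p
    by (intro blended_fraction_has_derivative Q_has_derivative assms) auto
qed (use assms g_eq in \<open>auto simp: Q_def\<close>)

text \<open>
  The growth exponents of the two factors of \<open>Q\<close> add up: \<open>k + 1\<close> from the weight product, by the
  bound on \<^const>\<open>q_fun\<close>, and \<open>p - k\<close> from \<open>E\<close>.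
\<close>

lemma Q_growth:
  assumes "\<omega> \<in> {0<..<1}"
  shows "(\<omega> - d) * Q' \<omega> \<le> real (Suc p) * Q \<omega>"
proof -
  let ?P = "weight_product m d \<omega>"
  have P: "?P > 0"
    using assms by (simp add: weight_product_pos)
  have "(\<omega> - d) * weight_product_deriv m d \<omega> = ?P * (q_fun d \<omega> / m)"
    by (simp add: weight_product_deriv_def q_fun_def)
  also have "\<dots> \<le> ?P * real (k + 1)"
    using q_le[OF assms] P m by (intro mult_left_mono) (auto simp: field_simps)
  finally have "(\<omega> - d) * weight_product_deriv m d \<omega> * E (\<omega> - d) \<le> ?P * real (k + 1) * E (\<omega> - d)"
    using E_pos by (intro mult_right_mono) (auto simp: less_imp_le)
  moreover have "?P * ((\<omega> - d) * E' (\<omega> - d)) \<le> ?P * ((real p - real k) * E (\<omega> - d))"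
    using E_growth[of "\<omega> - d"] P by (intro mult_left_mono) auto
  ultimately show ?thesis
    by (simp add: Q'_def Q_def algebra_simps)
qed

lemma G'_nonneg:
  assumes "\<omega> \<in> {0<..<1}"
  shows "G' \<omega> \<ge> 0"
  unfolding G'_def using Q_growth[OF assms] power_nonneg[of "\<omega> - d"]
  by (auto intro!: divide_nonneg_nonneg mult_nonneg_nonneg)

lemma fixed_points: "g 0 = 0" "g 1 = 1" "g d = d"
  using g_eq[of 0] g_eq[of 1] g_eq[of d] d A by (auto simp: weight_product_def)

lemma contact_at_weight:
  shows times_differentiable: "times_differentiable_at (Suc p) g d"
    and higher_deriv_eq_0: "\<forall>j\<in>{1..p}. (deriv ^^ j) g d = 0"
    and higher_deriv_neq_0: "(deriv ^^ Suc p) g d \<noteq> 0"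
proof -
  define S where "S = {0<..<1} \<inter> (\<lambda>\<omega>. \<omega> - d) -` T"
  have S: "open S" "d \<in> S"
    using T d by (auto simp: S_def intro!: open_Int open_vimage continuous_intros)
  \<comment> \<open>The cofactor of \<open>(\<omega> - d)^(p+1)\<close>, with \<open>E\<close> replaced by one of its smooth branches and the
    weight product in the form to which the closure rules apply.\<close>
  define quotient where "quotient = (\<lambda>B \<omega>. A / (A * (\<omega> - d) ^ p +
    exp (d / (m * \<omega>) * ln \<omega> + (1 - d) / (m * (1 - \<omega>)) * ln (1 - \<omega>)) * B (\<omega> - d)))"
  have quotient: "differentiable_upto (Suc p) S (quotient B)"
    if "differentiable_upto (Suc p) T B" "\<And>x. x \<in> T \<Longrightarrow> B x > 0" for B
    unfolding quotient_def
  proof (intro differentiable_upto_intros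
      differentiable_upto_compose[OF differentiable_upto_exp _ UNIV_I]
      differentiable_upto_compose[OF differentiable_upto_ln]
      differentiable_upto_compose[OF that(1)])
    fix \<omega> assume "\<omega> \<in> S"
    then show "A * (\<omega> - d) ^ p +
        exp (d / (m * \<omega>) * ln \<omega> + (1 - d) / (m * (1 - \<omega>)) * ln (1 - \<omega>)) * B (\<omega> - d) \<noteq> 0"
      using power_nonneg[of "\<omega> - d"] that(2)[of "\<omega> - d"]
      by (intro order.strict_implies_not_eq[symmetric] add_nonneg_pos mult_pos_pos) (auto simp: S_def)
  qed (use m in \<open>auto simp: S_def\<close>)
  have order: "times_differentiable_at (Suc p) g d \<and> (\<forall>j\<in>{1..p}. (deriv ^^ j) g d = 0) \<and>
      (deriv ^^ Suc p) g d = fact (Suc p) * quotient Er d"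
  proof (rule contact_order[OF S quotient[OF Er(1,2)] quotient[OF El(1,2)]])
    show "quotient Er d = quotient El d"
      using Er(3)[OF T(2)] El(3)[OF T(2)] by (simp add: quotient_def)
    show "g x = d + (x - d) ^ Suc p * quotient Er x" if "x \<in> S" "d \<le> x" for x
      using that g_eq[of x] Er(3)[of "x - d"] by (simp add: S_def quotient_def weight_product_eq_exp mult_ac)
    show "g x = d + (x - d) ^ Suc p * quotient El x" if "x \<in> S" "x \<le> d" for x
      using that g_eq[of x] El(3)[of "x - d"] by (simp add: S_def quotient_def weight_product_eq_exp mult_ac)
  qed
  have "quotient Er d > 0"
    unfolding quotient_def using A power_nonneg[of "d - d"] Er(2)[OF T(2)]
    by (intro divide_pos_pos add_nonneg_pos mult_pos_pos) auto
  then have "fact (Suc p) * quotient Er d > 0"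
    by (intro mult_pos_pos fact_gt_zero)
  then show "(deriv ^^ Suc p) g d \<noteq> 0"
    unfolding conjunct2[OF conjunct2[OF order]] by (rule less_imp_neq[symmetric])
  show "times_differentiable_at (Suc p) g d"
    by (rule conjunct1[OF order])
  show "\<forall>j\<in>{1..p}. (deriv ^^ j) g d = 0"
    by (rule conjunct1[OF conjunct2[OF order]])
qed

text \<open>
  The quotient rule is unavailable at \<open>d\<close>, where \<open>E\<close> may have its corner; there the order of
  contact supplies the derivative.
\<close>

lemma deriv_nonneg:
  assumes "\<omega> \<in> {0<..<1}"
  shows "g field_differentiable (at \<omega>) \<and> deriv g \<omega> \<ge> 0"
proof (cases "\<omega> = d")
  case True
  have "g field_differentiable (at d)"
    by (rule times_differentiable_at_imp_field_differentiable[OF times_differentiable])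
  moreover have "deriv g d = 0"
    using bspec[OF higher_deriv_eq_0, of 1] p(2) by simp
  ultimately show ?thesis
    using True by simp
next
  case False
  note D = has_derivative_G'[OF assms False]
  then have "g field_differentiable (at \<omega>)"
    by (auto simp: field_differentiable_def)
  moreover have "deriv g \<omega> \<ge> 0"
    unfolding DERIV_imp_deriv[OF D] by (rule G'_nonneg[OF assms])
  ultimately show ?thesis ..
qed

text \<open>
  With \<open>Q\<close> and \<open>Q'\<close> tending to 0, only \<open>(A x^p)^2 / (A x^p)^2\<close> is left of \<open>G'\<close>. The filter is
  kept general so that both endpoints are covered.
\<close>

lemma deriv_tendsto_1:
  assumes F: "(weight_product m d \<longlongrightarrow> 0) F" "(weight_product_deriv m d \<longlongrightarrow> 0) F"
      "((\<lambda>\<omega>. \<omega>) \<longlongrightarrow> e) F" "e \<noteq> d" "\<forall>\<^sub>F \<omega> in F. \<omega> \<in> {0<..<1} \<and> \<omega> \<noteq> d"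
  shows "(deriv g \<longlongrightarrow> 1) F"
proof -
  have x: "((\<lambda>\<omega>. \<omega> - d) \<longlongrightarrow> e - d) F"
    by (intro tendsto_intros F)
  have E: "((\<lambda>\<omega>. E (\<omega> - d)) \<longlongrightarrow> E (e - d)) F" "((\<lambda>\<omega>. E' (\<omega> - d)) \<longlongrightarrow> E' (e - d)) F"
    using F(4) E'_cont[of "e - d"] DERIV_isCont[OF E_deriv[of "e - d"]]
    by (auto intro: isCont_tendsto_compose[OF _ x])
  have Q: "(Q \<longlongrightarrow> 0 * E (e - d)) F" "(Q' \<longlongrightarrow> 0 * E (e - d) + E' (e - d) * 0) F"
    unfolding Q_def[abs_def] Q'_def[abs_def] by (intro tendsto_intros F E)+
  have nz: "A * (e - d) ^ p \<noteq> 0"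
    using A F(4) by simp
  then have "(G' \<longlongrightarrow> A * (e - d) ^ p *
      (A * (e - d) ^ p + (real (Suc p) * (0 * E (e - d)) - (e - d) * (0 * E (e - d) + E' (e - d) * 0))) /
      (A * (e - d) ^ p + 0 * E (e - d))\<^sup>2) F"
    unfolding G'_def[abs_def] by (intro tendsto_intros Q x) auto
  then have "(G' \<longlongrightarrow> 1) F"
    using nz F(4) by (simp add: power2_eq_square)
  then show ?thesis
    by (rule Lim_transform_eventually)
      (use F(5) in \<open>auto elim!: eventually_mono simp: DERIV_imp_deriv[OF has_derivative_G']\<close>)
qed

lemma deriv_at_endpoints:
  shows deriv_tendsto_1_at_0: "(deriv g \<longlongrightarrow> 1) (at_right 0)"
    and deriv_tendsto_1_at_1: "(deriv g \<longlongrightarrow> 1) (at_left 1)"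
proof -
  have "\<forall>\<^sub>F \<omega> in at_right 0. \<omega> \<in> {0<..<1} \<and> \<omega> \<noteq> d"
    unfolding eventually_at_right_field using d by (intro exI[of _ d]) auto
  then show "(deriv g \<longlongrightarrow> 1) (at_right 0)"
    using d m by (intro deriv_tendsto_1[of _ 0] weight_product_tendsto_0 tendsto_intros) auto
  have "\<forall>\<^sub>F \<omega> in at_left 1. \<omega> \<in> {0<..<1} \<and> \<omega> \<noteq> d"
    unfolding eventually_at_left_field using d by (intro exI[of _ d]) auto
  then show "(deriv g \<longlongrightarrow> 1) (at_left 1)"
    using d m by (intro deriv_tendsto_1[of _ 1] weight_product_tendsto_0 tendsto_intros) auto
qed

lemmas properties = fixed_points times_differentiable higher_deriv_eq_0 higher_deriv_neq_0
  deriv_tendsto_1_at_0 deriv_tendsto_1_at_1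

end

section \<open>The smoothed sign function\<close>

text \<open>
  This is why the definition of the smoothed sign by cases is differentiable at \<open>\<bar>x\<bar> = \<delta>\<close>.
\<close>

lemma max_0_power_has_derivative:
  "((\<lambda>y::real. max 0 y ^ Suc (Suc n)) has_real_derivative real (Suc (Suc n)) * max 0 y ^ Suc n) (at y)"
proof -
  consider "y > 0" | "y < 0" | "y = 0"
    by linarith
  then show ?thesis
  proof cases
    case 1
    have "((\<lambda>y. y ^ Suc (Suc n)) has_real_derivative real (Suc (Suc n)) * y ^ Suc n) (at y)"
      using DERIV_pow[of "Suc (Suc n)" y UNIV] by simp
    then have "((\<lambda>y. max 0 y ^ Suc (Suc n)) has_real_derivative real (Suc (Suc n)) * y ^ Suc n) (at y)"
      by (rule has_field_derivative_transform_within_open[where S = "{0<..}"]) (use 1 in auto)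
    then show ?thesis
      using 1 by (simp add: max_def)
  next
    case 2
    have "((\<lambda>y. max 0 y ^ Suc (Suc n)) has_real_derivative 0) (at y)"
      by (rule has_field_derivative_transform_within_open[where S = "{..<0}" and f = "\<lambda>_. 0"])
        (use 2 in \<open>auto simp: max_def\<close>)
    then show ?thesis
      using 2 by (simp add: max_def)
  next
    case 3
    have "isCont (\<lambda>y::real. max 0 y ^ Suc n) 0"
      by (intro continuous_intros)
    then show ?thesis
      unfolding 3 CARAT_DERIV
      by (intro exI[of _ "\<lambda>y. max 0 y ^ Suc n"]) (auto simp: max_def)
  qed
qed

text \<open>
  The positive part extends the denominator of the inner branch to the whole line: for
  \<open>\<bar>x\<bar> \<ge> \<delta>\<close> only \<open>\<bar>x\<bar>\<close> remains, which is the outer branch.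
\<close>

definition sg_denom :: "nat \<Rightarrow> real \<Rightarrow> real \<Rightarrow> real" where
  "sg_denom k \<delta> x = max 0 (\<delta>\<^sup>2 - x\<^sup>2) ^ (k + 3) + \<bar>x\<bar>"

definition sg_denom_deriv :: "nat \<Rightarrow> real \<Rightarrow> real \<Rightarrow> real" where
  "sg_denom_deriv k \<delta> x = real (k + 3) * max 0 (\<delta>\<^sup>2 - x\<^sup>2) ^ (k + 2) * (- 2 * x) + sgn x"

lemma square_less_iff_abs_less:
  fixes x \<delta> :: real
  assumes "\<delta> > 0"
  shows "x\<^sup>2 < \<delta>\<^sup>2 \<longleftrightarrow> \<bar>x\<bar> < \<delta>"
  using assms abs_le_square_iff[of \<delta> x] by linarith

lemma sg_eq_divide_sg_denom:
  assumes "\<delta> > 0"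
  shows "sg k \<delta> x = x / sg_denom k \<delta> x"
proof (cases "\<bar>x\<bar> < \<delta>")
  case True
  then have "max 0 (\<delta>\<^sup>2 - x\<^sup>2) = \<delta>\<^sup>2 - x\<^sup>2"
    using square_less_iff_abs_less[OF assms, of x] by simp
  with True show ?thesis
    by (simp add: sg_def sg_denom_def)
next
  case False
  then have "max 0 (\<delta>\<^sup>2 - x\<^sup>2) = 0"
    using square_less_iff_abs_less[OF assms, of x] by simp
  with False show ?thesis
    by (simp add: sg_def sg_denom_def)
qed

lemma sg_denom_pos: "\<delta> > 0 \<Longrightarrow> sg_denom k \<delta> x > 0"
  by (cases "x = 0") (auto simp: sg_denom_def intro!: add_nonneg_pos)

lemma sg_denom_has_derivative:
  assumes "x \<noteq> 0"
  shows "(sg_denom k \<delta> has_real_derivative sg_denom_deriv k \<delta> x) (at x)"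
proof -
  have "((\<lambda>x. \<delta>\<^sup>2 - x\<^sup>2) has_real_derivative (- 2 * x)) (at x)"
    by (auto intro!: derivative_eq_intros)
  from DERIV_chain2[OF max_0_power_has_derivative[of "k + 1"] this]
  have "((\<lambda>x. max 0 (\<delta>\<^sup>2 - x\<^sup>2) ^ (k + 3)) has_real_derivative
      real (k + 3) * max 0 (\<delta>\<^sup>2 - x\<^sup>2) ^ (k + 2) * (- 2 * x)) (at x)"
    by (simp add: numeral_eq_Suc)
  moreover have "(abs has_real_derivative sgn x) (at x)"
  proof (rule has_field_derivative_transform_within_open[where f = "\<lambda>y. sgn x * y"])
    show "((\<lambda>y. sgn x * y) has_real_derivative sgn x) (at x)"
      by (auto intro!: derivative_eq_intros)
    show "open (if x > 0 then {0<..} else {..<0 :: real})"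
      by simp
  qed (use assms in \<open>auto simp: sgn_if split: if_splits\<close>)
  ultimately show ?thesis
    unfolding sg_denom_def[abs_def] sg_denom_deriv_def by (rule DERIV_add)
qed

lemma isCont_sg_denom_deriv: "x \<noteq> 0 \<Longrightarrow> isCont (sg_denom_deriv k \<delta>) x"
  unfolding sg_denom_deriv_def[abs_def] by (intro continuous_intros) auto

text \<open>
  The bump decreases away from 0, so it contributes negatively to the left-hand side, while
  \<open>\<bar>x\<bar>\<close> is homogeneous of degree 1.
\<close>

lemma sg_denom_growth: "x * sg_denom_deriv k \<delta> x \<le> sg_denom k \<delta> x"
proof -
  have "x * sg_denom_deriv k \<delta> x = \<bar>x\<bar> - 2 * x\<^sup>2 * (real (k + 3) * max 0 (\<delta>\<^sup>2 - x\<^sup>2) ^ (k + 2))"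
    by (simp add: sg_denom_deriv_def algebra_simps power2_eq_square abs_sgn)
  also have "\<dots> \<le> \<bar>x\<bar>"
    by simp
  also have "\<dots> \<le> sg_denom k \<delta> x"
    by (simp add: sg_denom_def)
  finally show ?thesis .
qed

theorem theorem1:
  fixes k r s :: nat and A \<delta> M \<alpha> m d :: real and g :: "real \<Rightarrow> real"
  assumes "k \<ge> 1" and "A > 0" and "\<delta> > 0"
    and "r \<in> {2..9}" and "s \<in> {0..r - 1}" and "d = optimal_weight r s"
    and "\<alpha> > max 0 (SUP \<omega>\<in>{0<..<1}. q_fun d \<omega>)"
    and "M > 0" and "m \<in> {\<alpha> / real (k + 1)..<M}"
    and "g = g_MAIM1 k A \<delta> m d"
  shows "(g 0 = 0 \<and> g 1 = 1 \<and> g d = d) \<and>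
    (\<forall>\<omega>\<in>{0<..<1}. g field_differentiable (at \<omega>) \<and> deriv g \<omega> \<ge> 0) \<and>
    (\<forall>n\<ge>1. k = 2 * n \<longrightarrow>
        times_differentiable_at (k + 1) g d \<and>
        (\<forall>j\<in>{1..k}. (deriv ^^ j) g d = 0) \<and> (deriv ^^ (k + 1)) g d \<noteq> 0) \<and>
    (\<forall>n\<ge>1. k = 2 * n - 1 \<longrightarrow>
        times_differentiable_at (k + 2) g d \<and>
        (\<forall>j\<in>{1..k + 1}. (deriv ^^ j) g d = 0) \<and> (deriv ^^ (k + 2)) g d \<noteq> 0) \<and>
    (deriv g \<longlongrightarrow> 1) (at_right 0) \<and> (deriv g \<longlongrightarrow> 1) (at_left 1)"
proof -
  have d: "0 < d" "d < 1"
    using optimal_weight_in_unit_interval[of r s] assms(4-6) by auto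
  have "0 < \<alpha> / real (k + 1)"
    using assms(7) by simp
  then have m: "m > 0"
    using assms(9) by simp
  have q: "q_fun d \<omega> \<le> real (k + 1) * m" if "\<omega> \<in> {0<..<1}" for \<omega>
  proof -
    have "q_fun d \<omega> < \<alpha>"
      using q_fun_less_of_Sup_less[OF d _ that] assms(7) by simp
    also have "\<alpha> \<le> real (k + 1) * m"
      using assms(9) by (simp add: field_simps)
    finally show ?thesis
      by simp
  qed
  show ?thesis
  proof (cases "even k")
    case True
    have g: "g \<omega> = d + A * (\<omega> - d) ^ Suc k / (A * (\<omega> - d) ^ k + weight_product m d \<omega> * 1)" for \<omega>
      using True by (simp add: assms(10) g_MAIM1_def f_MAIM_def)
    interpret blended_mapping d A m k k "\<lambda>_. 1" "\<lambda>_. 0" "\<lambda>_. 1" "\<lambda>_. 1" g UNIV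
      by unfold_locales
        (use d assms(1,2) m True q g in \<open>auto simp del: differentiable_upto.simps intro: differentiable_upto_const\<close>)
    have k: "k \<noteq> 2 * n - 1" if "n \<ge> 1" for n
      using True that by presburger
    show ?thesis
      by (intro conjI allI ballI impI)
        (use properties[unfolded Suc_eq_plus1] deriv_nonneg k in \<open>blast+\<close>)
  next
    case False
    let ?E = "sg_denom k \<delta>"
    have g: "g \<omega> = d + A * (\<omega> - d) ^ Suc (k + 1) /
        (A * (\<omega> - d) ^ (k + 1) + weight_product m d \<omega> * ?E (\<omega> - d))" for \<omega>
    proof -
      have "?E (\<omega> - d) > 0"
        using assms(3) by (rule sg_denom_pos)
      then have "A * (\<omega> - d) / ?E (\<omega> - d) * (\<omega> - d) ^ k + weight_product m d \<omega> =
          (A * (\<omega> - d) ^ (k + 1) + weight_product m d \<omega> * ?E (\<omega> - d)) / ?E (\<omega> - d)"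
        by (simp add: field_simps)
      with \<open>?E (\<omega> - d) > 0\<close> show ?thesis
        using False by (simp add: assms(10) g_MAIM1_def f_MAIM_def sg_eq_divide_sg_denom[OF assms(3)])
    qed
    define D where "D = (\<lambda>x. (\<delta>\<^sup>2 - x\<^sup>2) ^ (k + 3))"
    \<comment> \<open>Inside \<open>\<bar>x\<bar> < \<delta>\<close> the positive part can be dropped; the second condition keeps the
      branches \<open>D x + x\<close> and \<open>D x - x\<close> positive on both sides of 0.\<close>
    define T where "T = {x. x\<^sup>2 < \<delta>\<^sup>2 \<and> \<bar>x\<bar> < D x}"
    have T: "open T" "0 \<in> T"
      using assms(3) by (auto simp: T_def D_def intro!: open_Collect_conj open_Collect_less continuous_intros)
    have E: "?E x = D x + \<bar>x\<bar>" if "x \<in> T" for x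
      using that by (simp add: T_def D_def sg_denom_def)
    have D: "differentiable_upto (Suc (k + 1)) T D"
      unfolding D_def by (intro differentiable_upto_intros)
    interpret blended_mapping d A m k "k + 1" ?E "sg_denom_deriv k \<delta>" "\<lambda>x. D x + x" "\<lambda>x. D x - x" g T
    proof
      show "differentiable_upto (Suc (k + 1)) T (\<lambda>x. D x + x)"
        "differentiable_upto (Suc (k + 1)) T (\<lambda>x. D x - x)"
        by (intro differentiable_upto_intros D)+
      show "x * sg_denom_deriv k \<delta> x \<le> (real (k + 1) - real k) * ?E x" for x
        using sg_denom_growth by simp
    qed (use d assms(2,3) m False q g T E in
        \<open>auto simp: T_def sg_denom_pos sg_denom_has_derivative isCont_sg_denom_deriv\<close>)
    have k: "k \<noteq> 2 * n" for n
      using False by presburger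
    show ?thesis
      by (intro conjI allI ballI impI)
        (use properties[unfolded Suc_eq_plus1 add.assoc one_add_one] deriv_nonneg k in \<open>blast+\<close>)
  qed
qed

end
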